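(* Let $n\ge 2$, let $\mathcal{G}$ be a connected undirected graph on the node set $\{1,\dots,n\}$ with degree matrix $\Delta(\mathcal{G})$, adjacency matrix $\mathcal{A}(\mathcal{G})$ and Laplacian $\mathcal{L}(\mathcal{G})=\Delta(\mathcal{G})-\mathcal{A}(\mathcal{G})$, and let $\alpha>0$. Let $T\in\mathbb{R}^{n\times n}$ be the invertible matrix for which $T\hat{x}=[\hat{x}_1-\hat{x}_2,\ \hat{x}_1-\hat{x}_3,\ \dots,\ \hat{x}_1-\hat{x}_n,\ \sum_{i=1}^n\hat{x}_i]^{\mathrm{T}}$ for all $\hat{x}\in\mathbb{R}^n$. Let $A_1\in\mathbb{R}^{(n-1)\times(n-1)}$ be the matrix obtained by removing the $n$-th row and the $n$-th column from $-T\mathcal{L}(\mathcal{G})T^{-1}$, and let $A_2\in\mathbb{R}^{(n-1)\times n}$ be the matrix obtained by removing the $n$-th row from $T\mathcal{A}(\mathcal{G})$. Consider the linear system $$\dot{\hat{z}}_1(t)=A_1\hat{z}_1(t)+A_2\tilde{x}(t),\qquad \hat{z}_1(t_0)=\hat{z}_{10},$$ $$\dot{\tilde{x}}(t)=-\Delta(\mathcal{G})\tilde{x}(t)-\tilde{w}(t),\qquad \tilde{x}(t_0)=\tilde{x}_0,$$ $$\dot{\tilde{w}}(t)=\alpha\tilde{x}(t),\qquad \tilde{w}(t_0)=\tilde{w}_0,$$ for $t\ge t_0$, where $\hat{z}_1(t)\in\mathbb{R}^{n-1}$ and $\tilde{x}(t),\tilde{w}(t)\in\mathbb{R}^n$.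 Then the solution $(\hat{z}_1(t),\tilde{x}(t),\tilde{w}(t))$ is exponentially stable for all $(\hat{z}_{10},\tilde{x}_0,\tilde{w}_0)\in\mathbb{R}^{n-1}\times\mathbb{R}^n\times\mathbb{R}^n$; that is, there exist constants $c,\lambda>0$ such that for every initial condition and all $t\ge t_0$, $$\|(\hat{z}_1(t),\tilde{x}(t),\tilde{w}(t))\|\le c\,e^{-\lambda(t-t_0)}\,\|(\hat{z}_{10},\tilde{x}_0,\tilde{w}_0)\|.$$
   Context: Graphs have edge set $\mathcal{E}_{\mathcal{G}}\subset\{1,\dots,n\}\times\{1,\dots,n\}$ consisting of unordered pairs of distinct nodes. The adjacency matrix has $[\mathcal{A}(\mathcal{G})]_{ij}=1$ if $(i,j)\in\mathcal{E}_{\mathcal{G}}$ and $0$ otherwise. The degree $d_i$ of node $i$ is its number of neighbors, and $\Delta(\mathcal{G})=\mathrm{diag}(d_1,\dots,d_n)$. The norm $\|\cdot\|$ is the Euclidean norm. In the networked multiagent interpretation (scalar agent states, constant unknown disturbances), $\hat{x}\in\mathbb{R}^n$ is the aggregated state of the distributed state emulators, $\tilde{x}$ is the aggregated error between agent states and emulator states, $\tilde{w}$ is the aggregated disturbance estimate error, $\alpha$ is the adaptation gain, and $\hat{z}_1=[\hat{x}_1-\hat{x}_2,\dots,\hat{x}_1-\hat{x}_n]^{\mathrm{T}}$ collects the emulator state differences. *)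

theory Defs
  imports
    "HOL-Analysis.Analysis"
    "Graph_Theory.Graph_Theory"
    "Jordan_Normal_Form.Determinant"
begin

text \<open>
  An undirected simple graph is a \<open>pair_graph\<close>: its edge set is a symmetric, irreflexive relation
  on a finite vertex set, so each unordered edge is stored in both orientations. Nodes are
  \<open>1, \<dots>, n\<close>, whereas matrix and vector indices start at 0, so index \<open>i\<close> belongs to node \<open>Suc i\<close>.
\<close>

definition adjacency_matrix :: "nat \<Rightarrow> nat pair_pre_digraph \<Rightarrow> real mat" where
  "adjacency_matrix n G =
     Matrix.mat n n (\<lambda>(i, j). if (Suc i, Suc j) \<in> parcs G then 1 else 0)"

definition node_degree :: "nat pair_pre_digraph \<Rightarrow> nat \<Rightarrow> nat" where
  "node_degree G v = card {u \<in> pverts G. (v, u) \<in> parcs G}"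

definition degree_matrix :: "nat \<Rightarrow> nat pair_pre_digraph \<Rightarrow> real mat" where
  "degree_matrix n G = mat_diag n (\<lambda>i. real (node_degree G (Suc i)))"

definition laplacian_matrix :: "nat \<Rightarrow> nat pair_pre_digraph \<Rightarrow> real mat" where
  "laplacian_matrix n G = degree_matrix n G - adjacency_matrix n G"

definition differences_and_sum :: "nat \<Rightarrow> real vec \<Rightarrow> real vec" where
  "differences_and_sum n x =
     Matrix.vec n (\<lambda>i. if i < n - 1 then vec_index x 0 - vec_index x (Suc i)
                       else (\<Sum>j<n. vec_index x j))"

definition delete_row :: "'a mat \<Rightarrow> nat \<Rightarrow> 'a mat" where
  "delete_row A k =
     Matrix.mat (dim_row A - 1) (dim_col A) (\<lambda>(i, j). A $$ (if i < k then i else Suc i, j))"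

definition euclidean_norm :: "real vec \<Rightarrow> real" where
  "euclidean_norm v = L2_set (vec_index v) {..<dim_vec v}"

text \<open>
  \<open>real vec\<close> is not a normed type (it contains vectors of all lengths), so differentiability of a
  curve of vectors is taken componentwise, for curves of constant length on \<open>S\<close>.
\<close>

definition has_vec_derivative_within ::
    "(real \<Rightarrow> real vec) \<Rightarrow> real vec \<Rightarrow> real \<Rightarrow> real set \<Rightarrow> bool" where
  "has_vec_derivative_within f d t S \<longleftrightarrow>
     (\<forall>s\<in>S. dim_vec (f s) = dim_vec d) \<and>
     (\<forall>i<dim_vec d. ((\<lambda>s. vec_index (f s) i) has_real_derivative vec_index d i) (at t within S))"

end

theory Submission
  imports Defs
begin

text \<open>
  The differences \<open>z\<close> are those of a unique mean-free state \<open>u\<close>, which obeys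
  \<open>u' = - L u + A x\<close> up to a multiple of the all-ones vector. On mean-free vectors the Laplacian
  quadratic form of a connected graph is coercive. The pair \<open>(x, w)\<close> splits into damped oscillators
  \<open>x' = - d x - w\<close>, \<open>w' = \<alpha> x\<close> with degree \<open>d \<ge> 1\<close>, and each has the strict Lyapunov function
  \<open>\<alpha> x\<^sup>2 + w\<^sup>2 + 2 \<epsilon> x w\<close> for small \<open>\<epsilon>\<close>. A large multiple \<open>K\<close> of the sum of these absorbs the
  coupling \<open>2 u \<cdot> A x\<close>, so \<open>V = |u|\<^sup>2 + K \<Sum> (\<alpha> x\<^sup>2 + w\<^sup>2 + 2 \<epsilon> x w)\<close> satisfies \<open>V' \<le> - \<mu> V\<close>.
\<close>

section \<open>Exponential decay from a differential inequality\<close>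

text \<open>The integrating factor \<open>exp (\<mu> * (s - a))\<close> turns the inequality into a
  nonpositive derivative, so the product never exceeds its value at \<open>a\<close>.\<close>

lemma exponential_decay:
  fixes f f' :: "real \<Rightarrow> real"
  assumes deriv: "\<And>t. t \<ge> a \<Longrightarrow> (f has_real_derivative f' t) (at t within {a..})"
    and le: "\<And>t. t \<ge> a \<Longrightarrow> f' t \<le> - \<mu> * f t"
    and "a \<le> t"
  shows "f t \<le> f a * exp (- \<mu> * (t - a))"
proof -
  define g where "g s = f s * exp (\<mu> * (s - a))" for s
  have g_deriv: "(g has_real_derivative (f' s + \<mu> * f s) * exp (\<mu> * (s - a))) (at s within {a..})"
    if "a \<le> s" for s
    unfolding g_def
    using deriv[OF that] by (auto intro!: derivative_eq_intros simp: algebra_simps)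
  have "g t \<le> g a"
  \<comment> \<open>Interior points have \<open>{a..}\<close> as a neighbourhood, so the derivative
    there is two-sided; at \<open>a\<close> continuity suffices.\<close>
  proof (rule DERIV_nonpos_imp_decreasing_open[OF \<open>a \<le> t\<close>])
    fix s assume "a < s" "s < t"
    then have "(g has_real_derivative (f' s + \<mu> * f s) * exp (\<mu> * (s - a))) (at s)"
      using DERIV_subset[OF g_deriv, of s "{a<..}"] at_within_open[of s "{a<..}"]
      by (auto simp: subset_eq)
    moreover have "(f' s + \<mu> * f s) * exp (\<mu> * (s - a)) \<le> 0"
      using le[of s] \<open>a < s\<close> by (intro mult_nonpos_nonneg) auto
    ultimately show "\<exists>y. (g has_real_derivative y) (at s) \<and> y \<le> 0"
      by blast
  next
    have "continuous_on {a..} g"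
      unfolding continuous_on_eq_continuous_within by (auto intro!: DERIV_continuous g_deriv)
    then show "continuous_on {a..t} g"
      by (rule continuous_on_subset) auto
  qed
  then have "f t * exp (\<mu> * (t - a)) \<le> f a"
    by (simp add: g_def)
  then have "f t * exp (\<mu> * (t - a)) * exp (- \<mu> * (t - a)) \<le> f a * exp (- \<mu> * (t - a))"
    by (rule mult_right_mono) simp
  then show ?thesis
    by (simp add: mult.assoc flip: exp_add)
qed

section \<open>Energy of a single damped oscillator\<close>

definition node_energy :: "real \<Rightarrow> real \<Rightarrow> real \<Rightarrow> real \<Rightarrow> real" where
  "node_energy \<alpha> \<epsilon> x w = \<alpha> * x\<^sup>2 + w\<^sup>2 + 2 * \<epsilon> * x * w"

text \<open>The cross term of the energy makes it dissipate in \<open>w\<close> as well as in \<open>x\<close>.\<close>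

lemma node_energy_dissipation:
  fixes \<alpha> \<epsilon> d D x w :: real
  assumes "0 < \<alpha>" "0 \<le> \<epsilon>" "1 \<le> d" "d \<le> D" "\<epsilon> * (2 * \<alpha> + D\<^sup>2) \<le> \<alpha>"
  shows "2 * \<alpha> * x * (- d * x - w) + 2 * w * (\<alpha> * x)
           + 2 * \<epsilon> * ((- d * x - w) * w + x * (\<alpha> * x)) \<le> - \<alpha> * x\<^sup>2 - \<epsilon> * w\<^sup>2"
proof -
  have "\<epsilon> * d\<^sup>2 \<le> \<epsilon> * D\<^sup>2"
    using assms by (intro mult_left_mono power_mono) auto
  moreover have "\<alpha> \<le> \<alpha> * d"
    using assms by simp
  moreover have "2 * \<epsilon> * \<alpha> + \<epsilon> * D\<^sup>2 \<le> \<alpha>"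
    using assms by (simp add: algebra_simps)
  ultimately have "0 \<le> 2 * \<alpha> * d - \<alpha> - 2 * \<epsilon> * \<alpha> - \<epsilon> * d\<^sup>2"
    by linarith
  \<comment> \<open>This expression is the right side of the claim minus the left side: half of the
    damping \<open>- 2 * \<epsilon> * w\<^sup>2\<close> completes the square with the mixed term, at
    the cost of \<open>\<epsilon> * d\<^sup>2 * x\<^sup>2\<close>.\<close>
  then have "0 \<le> (2 * \<alpha> * d - \<alpha> - 2 * \<epsilon> * \<alpha> - \<epsilon> * d\<^sup>2) * x\<^sup>2 + \<epsilon> * (d * x + w)\<^sup>2"
    using assms by simp
  also have "\<dots> = - \<alpha> * x\<^sup>2 - \<epsilon> * w\<^sup>2 - (2 * \<alpha> * x * (- d * x - w) + 2 * w * (\<alpha> * x)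
           + 2 * \<epsilon> * ((- d * x - w) * w + x * (\<alpha> * x)))"
    by (simp add: power2_eq_square algebra_simps)
  finally show ?thesis by simp
qed

text \<open>The squares of \<open>w + 2 * \<epsilon> * x\<close> and
  \<open>w - 2 * \<epsilon> * x\<close> bound the cross term by half of
  \<open>\<alpha> * x\<^sup>2 + w\<^sup>2\<close>.\<close>

lemma node_energy_bounds:
  fixes \<alpha> \<epsilon> x w :: real
  assumes "0 < \<alpha>" "4 * \<epsilon>\<^sup>2 \<le> \<alpha>"
  shows "\<alpha> * x\<^sup>2 + w\<^sup>2 \<le> 2 * node_energy \<alpha> \<epsilon> x w" "node_energy \<alpha> \<epsilon> x w \<le> 2 * (\<alpha> * x\<^sup>2 + w\<^sup>2)"
proof -
  have "4 * \<epsilon>\<^sup>2 * x\<^sup>2 \<le> \<alpha> * x\<^sup>2"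
    using assms by (intro mult_right_mono) auto
  moreover have "0 \<le> (w + 2 * \<epsilon> * x)\<^sup>2" "0 \<le> (w - 2 * \<epsilon> * x)\<^sup>2"
    by simp_all
  ultimately have "\<bar>4 * \<epsilon> * x * w\<bar> \<le> \<alpha> * x\<^sup>2 + w\<^sup>2"
    by (simp add: power2_eq_square algebra_simps abs_le_iff)
  moreover have "0 \<le> \<alpha> * x\<^sup>2" "0 \<le> w\<^sup>2"
    using assms by simp_all
  ultimately show "\<alpha> * x\<^sup>2 + w\<^sup>2 \<le> 2 * node_energy \<alpha> \<epsilon> x w"
    "node_energy \<alpha> \<epsilon> x w \<le> 2 * (\<alpha> * x\<^sup>2 + w\<^sup>2)"
    by (simp_all add: node_energy_def abs_le_iff)
qed

text \<open>The witness \<open>\<alpha> / (2 * \<alpha> + D\<^sup>2)\<close> turns the first upper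
  bound into an equality; the second reduces to
  \<open>4 * \<alpha> \<le> (2 * \<alpha> + 1)\<^sup>2\<close>.\<close>

lemma exists_cross_weight:
  fixes \<alpha> D :: real
  assumes "0 < \<alpha>" "1 \<le> D"
  obtains \<epsilon> where "0 < \<epsilon>" "\<epsilon> * (2 * \<alpha> + D\<^sup>2) \<le> \<alpha>" "4 * \<epsilon>\<^sup>2 \<le> \<alpha>"
proof
  let ?m = "2 * \<alpha> + D\<^sup>2"
  have D2: "1 \<le> D\<^sup>2" using assms by simp
  have m: "0 < ?m" using assms D2 by linarith
  show "0 < \<alpha> / ?m" using assms m by simp
  show "\<alpha> / ?m * ?m \<le> \<alpha>" using m by simp
  have "4 * \<alpha> \<le> (2 * \<alpha> + 1)\<^sup>2"
    using assms by (simp add: power2_eq_square algebra_simps)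
  also have "\<dots> \<le> ?m\<^sup>2"
    using assms D2 by (intro power_mono) auto
  finally have "\<alpha> * (4 * \<alpha>) \<le> \<alpha> * ?m\<^sup>2"
    using assms by (intro mult_left_mono) auto
  moreover have "4 * (\<alpha> / ?m)\<^sup>2 = \<alpha> * (4 * \<alpha>) / ?m\<^sup>2"
    by (simp add: power_divide power2_eq_square)
  ultimately show "4 * (\<alpha> / ?m)\<^sup>2 \<le> \<alpha>"
    using m by (simp only: pos_divide_le_eq zero_less_power)
qed

section \<open>Quadratic forms of a weighted graph\<close>

text \<open>Expanding the squares gives two diagonal sums, which agree by symmetry of
  \<open>a\<close>. The factor 2 arises because every edge is counted in both orientations.\<close>

lemma laplacian_quadratic_form:
  fixes a :: "nat \<Rightarrow> nat \<Rightarrow> real" and u :: "nat \<Rightarrow> real"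
  assumes sym: "\<And>i j. i < n \<Longrightarrow> j < n \<Longrightarrow> a i j = a j i"
  shows "2 * (\<Sum>i<n. u i * ((\<Sum>j<n. a i j) * u i - (\<Sum>j<n. a i j * u j)))
           = (\<Sum>i<n. \<Sum>j<n. a i j * (u i - u j)\<^sup>2)"
proof -
  have swap: "(\<Sum>i<n. \<Sum>j<n. a i j * (u j)\<^sup>2) = (\<Sum>i<n. \<Sum>j<n. a i j * (u i)\<^sup>2)"
    by (subst sum.swap) (intro sum.cong refl, use sym in auto)
  have "(\<Sum>i<n. \<Sum>j<n. a i j * (u i - u j)\<^sup>2)
      = (\<Sum>i<n. \<Sum>j<n. a i j * (u i)\<^sup>2) + (\<Sum>i<n. \<Sum>j<n. a i j * (u j)\<^sup>2)
          - 2 * (\<Sum>i<n. \<Sum>j<n. a i j * u i * u j)"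
    by (simp add: power2_diff algebra_simps sum.distrib sum_subtractf sum_distrib_left)
  also have "\<dots> = 2 * ((\<Sum>i<n. \<Sum>j<n. a i j * (u i)\<^sup>2) - (\<Sum>i<n. \<Sum>j<n. a i j * u i * u j))"
    unfolding swap by simp
  also have "(\<Sum>i<n. \<Sum>j<n. a i j * (u i)\<^sup>2) - (\<Sum>i<n. \<Sum>j<n. a i j * u i * u j)
      = (\<Sum>i<n. u i * ((\<Sum>j<n. a i j) * u i - (\<Sum>j<n. a i j * u j)))"
    by (simp add: sum_subtractf sum_distrib_left sum_distrib_right algebra_simps power2_eq_square)
  finally show ?thesis by simp
qed

text \<open>Young's inequality is applied edge by edge; row sums, and by symmetry column sums, are
  at most \<open>D\<close>.\<close>

lemma adjacency_cross_term_le: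
  fixes a :: "nat \<Rightarrow> nat \<Rightarrow> real" and u x :: "nat \<Rightarrow> real"
  assumes sym: "\<And>i j. i < n \<Longrightarrow> j < n \<Longrightarrow> a i j = a j i"
    and nonneg: "\<And>i j. i < n \<Longrightarrow> j < n \<Longrightarrow> 0 \<le> a i j"
    and deg: "\<And>i. i < n \<Longrightarrow> (\<Sum>j<n. a i j) \<le> D"
    and "0 < \<kappa>" "0 < D"
  shows "2 * (\<Sum>i<n. u i * (\<Sum>j<n. a i j * x j))
           \<le> \<kappa> * (\<Sum>i<n. (u i)\<^sup>2) + D\<^sup>2 / \<kappa> * (\<Sum>i<n. (x i)\<^sup>2)"
proof -
  \<comment> \<open>With this weight \<open>\<eta> * D = \<kappa>\<close> and
    \<open>D / \<eta> = D\<^sup>2 / \<kappa>\<close>, the two coefficients wanted.\<close>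
  define \<eta> where "\<eta> = \<kappa> / D"
  have "0 < \<eta>" using assms by (simp add: \<eta>_def)
  have young: "2 * p * q \<le> \<eta> * p\<^sup>2 + q\<^sup>2 / \<eta>" for p q
  proof -
    have "0 \<le> (\<eta> * p - q)\<^sup>2 / \<eta>" using \<open>0 < \<eta>\<close> by simp
    also have "\<dots> = \<eta> * p\<^sup>2 + q\<^sup>2 / \<eta> - 2 * p * q"
      using \<open>0 < \<eta>\<close> by (simp add: power2_eq_square field_simps)
    finally show ?thesis by simp
  qed
  have row: "(\<Sum>i<n. \<Sum>j<n. a i j * (v i)\<^sup>2) \<le> D * (\<Sum>i<n. (v i)\<^sup>2)" for v :: "nat \<Rightarrow> real"
    unfolding sum_distrib_left sum_distrib_right[symmetric]
    by (intro sum_mono mult_right_mono deg) auto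
  have swap: "(\<Sum>i<n. \<Sum>j<n. a i j * (x j)\<^sup>2) = (\<Sum>i<n. \<Sum>j<n. a i j * (x i)\<^sup>2)"
    by (subst sum.swap) (intro sum.cong refl, use sym in auto)
  have "2 * (\<Sum>i<n. u i * (\<Sum>j<n. a i j * x j)) = (\<Sum>i<n. \<Sum>j<n. a i j * (2 * u i * x j))"
    by (simp add: sum_distrib_left algebra_simps)
  also have "\<dots> \<le> (\<Sum>i<n. \<Sum>j<n. a i j * (\<eta> * (u i)\<^sup>2 + (x j)\<^sup>2 / \<eta>))"
    by (intro sum_mono mult_left_mono young nonneg) auto
  also have "\<dots> = \<eta> * (\<Sum>i<n. \<Sum>j<n. a i j * (u i)\<^sup>2) + (\<Sum>i<n. \<Sum>j<n. a i j * (x j)\<^sup>2) / \<eta>"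
    by (simp add: sum_distrib_left sum.distrib sum_divide_distrib algebra_simps)
  also have "\<dots> \<le> \<eta> * (D * (\<Sum>i<n. (u i)\<^sup>2)) + (D * (\<Sum>i<n. (x i)\<^sup>2)) / \<eta>"
    unfolding swap using \<open>0 < \<eta>\<close> row by (intro add_mono mult_left_mono divide_right_mono) auto
  also have "\<dots> = \<kappa> * (\<Sum>i<n. (u i)\<^sup>2) + D\<^sup>2 / \<kappa> * (\<Sum>i<n. (x i)\<^sup>2)"
    using assms by (simp add: \<eta>_def power2_eq_square field_simps)
  finally show ?thesis .
qed

text \<open>The mean minimises the sum of squared distances: when it is zero, a shift by
  \<open>c\<close> only adds \<open>real n * c\<^sup>2\<close>.\<close>

lemma sum_squares_le_sum_squares_shifted:
  fixes u :: "nat \<Rightarrow> real"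
  assumes "(\<Sum>i<n. u i) = 0"
  shows "(\<Sum>i<n. (u i)\<^sup>2) \<le> (\<Sum>i<n. (u i - c)\<^sup>2)"
proof -
  have "(\<Sum>i<n. (u i - c)\<^sup>2) = (\<Sum>i<n. (u i)\<^sup>2) - 2 * c * (\<Sum>i<n. u i) + real n * c\<^sup>2"
    by (simp add: power2_diff sum.distrib sum_subtractf sum_distrib_left algebra_simps)
  then show ?thesis using assms by simp
qed

text \<open>Induction along a path: the squared difference across a new edge is at most the
  quadratic form divided by the edge weight, and it is joined to the earlier part by bounding the
  square of a sum by twice the sum of squares. The constant does not depend on
  \<open>u\<close>.\<close>

lemma reachable_difference_bound:
  fixes a :: "nat \<Rightarrow> nat \<Rightarrow> real"
  assumes nonneg: "\<And>i j. i < n \<Longrightarrow> j < n \<Longrightarrow> 0 \<le> a i j"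
    and "(p, q) \<in> {(i, j). i < n \<and> j < n \<and> 0 < a i j}\<^sup>*"
  shows "\<exists>C\<ge>0. \<forall>u :: nat \<Rightarrow> real. (u p - u q)\<^sup>2 \<le> C * (\<Sum>i<n. \<Sum>j<n. a i j * (u i - u j)\<^sup>2)"
  using assms(2)
proof (induction rule: rtrancl_induct)
  case base
  show ?case by (intro exI[of _ 0]) auto
next
  case (step q r)
  define Q where "Q u = (\<Sum>i<n. \<Sum>j<n. a i j * (u i - u j)\<^sup>2)" for u :: "nat \<Rightarrow> real"
  from step.IH obtain C where C: "0 \<le> C" "\<And>u. (u p - u q)\<^sup>2 \<le> C * Q u"
    unfolding Q_def by blast
  from step.hyps have qr: "q < n" "r < n" "0 < a q r" by auto
  have "(u p - u r)\<^sup>2 \<le> (2 * C + 2 / a q r) * Q u" for u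
  proof -
    have "a q r * (u q - u r)\<^sup>2 \<le> (\<Sum>j<n. a q j * (u q - u j)\<^sup>2)"
      using qr nonneg by (intro member_le_sum[where f = "\<lambda>j. a q j * (u q - u j)\<^sup>2"]) auto
    also have "\<dots> \<le> Q u"
      unfolding Q_def using qr nonneg
      by (intro member_le_sum[where f = "\<lambda>i. \<Sum>j<n. a i j * (u i - u j)\<^sup>2"] sum_nonneg) auto
    finally have "(u q - u r)\<^sup>2 \<le> Q u / a q r"
      using qr by (simp add: field_simps)
    moreover have "0 \<le> ((u p - u q) - (u q - u r))\<^sup>2" by simp
    then have "(u p - u r)\<^sup>2 \<le> 2 * (u p - u q)\<^sup>2 + 2 * (u q - u r)\<^sup>2"
      by (simp add: power2_eq_square algebra_simps)
    moreover have "(2 * C + 2 / a q r) * Q u = 2 * (C * Q u) + 2 * (Q u / a q r)"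
      by (simp add: algebra_simps)
    ultimately show ?thesis
      using C(2)[of u] by linarith
  qed
  moreover have "0 \<le> 2 * C + 2 / a q r" using C qr by simp
  ultimately show ?case unfolding Q_def by blast
qed

text \<open>The constant \<open>\<kappa>\<close> is a lower bound for the algebraic connectivity.\<close>

lemma connected_poincare:
  fixes a :: "nat \<Rightarrow> nat \<Rightarrow> real"
  assumes nonneg: "\<And>i j. i < n \<Longrightarrow> j < n \<Longrightarrow> 0 \<le> a i j"
    and conn: "\<And>i j. i < n \<Longrightarrow> j < n \<Longrightarrow> (i, j) \<in> {(i, j). i < n \<and> j < n \<and> 0 < a i j}\<^sup>*"
  obtains \<kappa> where "0 < \<kappa>"
    "\<And>u :: nat \<Rightarrow> real. (\<Sum>i<n. u i) = 0 \<Longrightarrow>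
       2 * \<kappa> * (\<Sum>i<n. (u i)\<^sup>2) \<le> (\<Sum>i<n. \<Sum>j<n. a i j * (u i - u j)\<^sup>2)"
proof -
  define Q where "Q u = (\<Sum>i<n. \<Sum>j<n. a i j * (u i - u j)\<^sup>2)" for u :: "nat \<Rightarrow> real"
  have Q_nonneg: "0 \<le> Q u" for u
    unfolding Q_def using nonneg by (intro sum_nonneg mult_nonneg_nonneg) auto
  \<comment> \<open>Node index 0 is a common reference: for mean-free \<open>u\<close>, replacing
    \<open>u i\<close> by \<open>u i - u 0\<close> can only enlarge the sum of squares.\<close>
  have "\<exists>C\<ge>0. \<forall>u. (u i - u 0)\<^sup>2 \<le> C * Q u" if "i < n" for i
    unfolding Q_def using nonneg conn that by (intro reachable_difference_bound) auto
  then obtain C where C: "\<And>i. i < n \<Longrightarrow> 0 \<le> C i"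
    "\<And>i u. i < n \<Longrightarrow> (u i - u 0)\<^sup>2 \<le> C i * Q u"
    by metis
  \<comment> \<open>The sum of the node constants serves all nodes at once; the added 1 keeps
    \<open>M\<close> positive even if they all vanish.\<close>
  define M where "M = (\<Sum>i<n. C i) + 1"
  have "0 \<le> (\<Sum>i<n. C i)" by (intro sum_nonneg C(1)) simp
  then have "0 < M" by (simp add: M_def)
  show ?thesis
  proof (rule that[of "1 / (2 * M)"])
    show "0 < 1 / (2 * M)" using \<open>0 < M\<close> by simp
    fix u :: "nat \<Rightarrow> real"
    assume "(\<Sum>i<n. u i) = 0"
    then have "(\<Sum>i<n. (u i)\<^sup>2) \<le> (\<Sum>i<n. (u i - u 0)\<^sup>2)"
      by (rule sum_squares_le_sum_squares_shifted)
    also have "\<dots> \<le> (\<Sum>i<n. C i * Q u)"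
      by (intro sum_mono C(2)) auto
    also have "\<dots> \<le> M * Q u"
      using Q_nonneg[of u] by (simp add: M_def distrib_right flip: sum_distrib_right)
    finally show "2 * (1 / (2 * M)) * (\<Sum>i<n. (u i)\<^sup>2) \<le> (\<Sum>i<n. \<Sum>j<n. a i j * (u i - u j)\<^sup>2)"
      using \<open>0 < M\<close> by (simp add: Q_def field_simps)
  qed
qed

section \<open>A Lyapunov function for the whole network\<close>

lemma node_energy_has_derivative:
  assumes "(x has_real_derivative x') (at t within S)" "(w has_real_derivative w') (at t within S)"
  shows "((\<lambda>s. node_energy \<alpha> \<epsilon> (x s) (w s)) has_real_derivative
           2 * \<alpha> * x t * x' + 2 * w t * w' + 2 * \<epsilon> * (x' * w t + x t * w')) (at t within S)"
proof -
  have "((\<lambda>s. \<alpha> * (x s)\<^sup>2 + (w s)\<^sup>2 + 2 * \<epsilon> * (x s * w s)) has_real_derivative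
      \<alpha> * (2 * x t * x') + 2 * w t * w' + 2 * \<epsilon> * (x' * w t + x t * w')) (at t within S)"
    using DERIV_power[OF assms(1), of 2] DERIV_power[OF assms(2), of 2] DERIV_mult[OF assms]
    by (intro DERIV_add DERIV_cmult) (simp_all add: algebra_simps)
  then show ?thesis
    by (simp add: node_energy_def mult.assoc mult.left_commute)
qed

text \<open>Replaces three separate coefficients by a common one, both in the lower bound on
  \<open>V\<close> and in its dissipation.\<close>

lemma min_mult_sum_le:
  fixes p q r :: real
  assumes "0 \<le> U" "0 \<le> X" "0 \<le> W"
  shows "min p (min q r) * (U + X + W) \<le> p * U + q * X + r * W"
proof -
  have "min p (min q r) * U \<le> p * U" "min p (min q r) * X \<le> q * X" "min p (min q r) * W \<le> r * W"
    using assms by (auto intro!: mult_right_mono)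
  then show ?thesis by (simp add: algebra_simps)
qed

text \<open>The vector \<open>u\<close> is the emulator state with its mean removed; \<open>m\<close> is the removed mean velocity.\<close>

lemma network_exponential_decay:
  fixes a :: "nat \<Rightarrow> nat \<Rightarrow> real" and \<alpha> \<kappa> :: real
  assumes sym: "\<And>i j. i < n \<Longrightarrow> j < n \<Longrightarrow> a i j = a j i"
    and nonneg: "\<And>i j. i < n \<Longrightarrow> j < n \<Longrightarrow> 0 \<le> a i j"
    and deg: "\<And>i. i < n \<Longrightarrow> 1 \<le> (\<Sum>j<n. a i j)"
    and "0 < \<alpha>" and "0 < \<kappa>"
    and poincare: "\<And>u :: nat \<Rightarrow> real. (\<Sum>i<n. u i) = 0 \<Longrightarrow>
       2 * \<kappa> * (\<Sum>i<n. (u i)\<^sup>2) \<le> (\<Sum>i<n. \<Sum>j<n. a i j * (u i - u j)\<^sup>2)"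
  obtains c \<mu> where "0 < c" "0 < \<mu>"
    "\<And>t\<^sub>0 t u x w m. (\<And>t. t \<ge> t\<^sub>0 \<Longrightarrow> (\<Sum>i<n. u i t) = 0) \<Longrightarrow>
      (\<And>t i. t \<ge> t\<^sub>0 \<Longrightarrow> i < n \<Longrightarrow> (u i has_real_derivative
        - ((\<Sum>j<n. a i j) * u i t - (\<Sum>j<n. a i j * u j t)) + (\<Sum>j<n. a i j * x j t) - m t)
          (at t within {t\<^sub>0..})) \<Longrightarrow>
      (\<And>t i. t \<ge> t\<^sub>0 \<Longrightarrow> i < n \<Longrightarrow> (x i has_real_derivative - (\<Sum>j<n. a i j) * x i t - w i t)
          (at t within {t\<^sub>0..})) \<Longrightarrow>
      (\<And>t i. t \<ge> t\<^sub>0 \<Longrightarrow> i < n \<Longrightarrow> (w i has_real_derivative \<alpha> * x i t) (at t within {t\<^sub>0..})) \<Longrightarrow>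
      t \<ge> t\<^sub>0 \<Longrightarrow>
      (\<Sum>i<n. (u i t)\<^sup>2) + (\<Sum>i<n. (x i t)\<^sup>2) + (\<Sum>i<n. (w i t)\<^sup>2) \<le>
        c * exp (- \<mu> * (t - t\<^sub>0)) *
          ((\<Sum>i<n. (u i t\<^sub>0)\<^sup>2) + (\<Sum>i<n. (x i t\<^sub>0)\<^sup>2) + (\<Sum>i<n. (w i t\<^sub>0)\<^sup>2))"
proof -
  define d where "d i = (\<Sum>j<n. a i j)" for i
  \<comment> \<open>A crude common bound on all degrees; the added 1 gives \<open>1 \<le> D\<close>
    even for an empty sum.\<close>
  define D where "D = (\<Sum>i<n. d i) + 1"
  have d_ge: "1 \<le> d i" if "i < n" for i using deg[OF that] by (simp add: d_def)
  have d_nonneg: "0 \<le> d i" if "i < n" for i using d_ge[OF that] by simp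
  have "0 \<le> (\<Sum>i<n. d i)" by (intro sum_nonneg d_nonneg) simp
  then have D_ge: "1 \<le> D" by (simp add: D_def)
  have d_le: "d i \<le> D" if "i < n" for i
    using member_le_sum[of i "{..<n}" d] that d_nonneg by (simp add: D_def)
  obtain \<epsilon> where eps: "0 < \<epsilon>" "\<epsilon> * (2 * \<alpha> + D\<^sup>2) \<le> \<alpha>" "4 * \<epsilon>\<^sup>2 \<le> \<alpha>"
    using exists_cross_weight[OF \<open>0 < \<alpha>\<close> D_ge] by blast
  \<comment> \<open>Chosen so that \<open>K * \<alpha> = 2 * (D\<^sup>2 / \<kappa>)\<close>: one
    half of the dissipation in \<open>X\<close> pays for the coupling, the other half
    remains.\<close>
  define K where "K = 2 * D\<^sup>2 / (\<kappa> * \<alpha>)"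
  have "0 < K" using D_ge \<open>0 < \<alpha>\<close> \<open>0 < \<kappa>\<close> by (simp add: K_def)
  \<comment> \<open>\<open>c1\<close> and \<open>c2\<close> compare \<open>V\<close> with
    \<open>U + X + W\<close> from below and above, and \<open>c3\<close> measures the dissipation;
    hence the rate \<open>c3 / c2\<close> and the factor \<open>c2 / c1\<close>.\<close>
  define c1 where "c1 = min 1 (min (K * \<alpha> / 2) (K / 2))"
  define c2 where "c2 = 1 + 2 * K * \<alpha> + 2 * K"
  define c3 where "c3 = min \<kappa> (min (D\<^sup>2 / \<kappa>) (K * \<epsilon>))"
  have pos: "0 < c1" "0 < c2" "0 < c3"
    using \<open>0 < K\<close> \<open>0 < \<alpha>\<close> \<open>0 < \<kappa>\<close> D_ge eps by (auto simp: c1_def c2_def c3_def add_pos_pos)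
  show ?thesis
  proof (rule that[of "c2 / c1" "c3 / c2"])
    show "0 < c2 / c1" "0 < c3 / c2" using pos by simp_all
    fix t\<^sub>0 t :: real and u x w :: "nat \<Rightarrow> real \<Rightarrow> real" and m :: "real \<Rightarrow> real"
    assume mean: "\<And>t. t \<ge> t\<^sub>0 \<Longrightarrow> (\<Sum>i<n. u i t) = 0"
      and du: "\<And>t i. t \<ge> t\<^sub>0 \<Longrightarrow> i < n \<Longrightarrow> (u i has_real_derivative
        - ((\<Sum>j<n. a i j) * u i t - (\<Sum>j<n. a i j * u j t)) + (\<Sum>j<n. a i j * x j t) - m t)
          (at t within {t\<^sub>0..})"
      and dx: "\<And>t i. t \<ge> t\<^sub>0 \<Longrightarrow> i < n \<Longrightarrow> (x i has_real_derivative
          - (\<Sum>j<n. a i j) * x i t - w i t) (at t within {t\<^sub>0..})"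
      and dw: "\<And>t i. t \<ge> t\<^sub>0 \<Longrightarrow> i < n \<Longrightarrow>
          (w i has_real_derivative \<alpha> * x i t) (at t within {t\<^sub>0..})"
      and "t \<ge> t\<^sub>0"
    define U X W where "U t = (\<Sum>i<n. (u i t)\<^sup>2)" and "X t = (\<Sum>i<n. (x i t)\<^sup>2)"
      and "W t = (\<Sum>i<n. (w i t)\<^sup>2)" for t
    have nonnegs: "0 \<le> U t" "0 \<le> X t" "0 \<le> W t" for t
      by (simp_all add: U_def X_def W_def sum_nonneg)
    define N where "N t = (\<Sum>i<n. node_energy \<alpha> \<epsilon> (x i t) (w i t))" for t
    define u' where "u' i t = - (d i * u i t - (\<Sum>j<n. a i j * u j t))
        + (\<Sum>j<n. a i j * x j t) - m t" for i t
    define x' where "x' i t = - d i * x i t - w i t" for i t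
    define U' where "U' t = (\<Sum>i<n. 2 * u i t * u' i t)" for t
    define N' where "N' t = (\<Sum>i<n. 2 * \<alpha> * x i t * x' i t + 2 * w i t * (\<alpha> * x i t)
        + 2 * \<epsilon> * (x' i t * w i t + x i t * (\<alpha> * x i t)))" for t
    have N_lower: "\<alpha> * X t + W t \<le> 2 * N t" and N_upper: "N t \<le> 2 * (\<alpha> * X t + W t)" for t
      unfolding N_def X_def W_def sum_distrib_left sum.distrib[symmetric]
      using node_energy_bounds[OF \<open>0 < \<alpha>\<close> eps(3)] by (intro sum_mono; simp)+
    have dU: "(U has_real_derivative U' s) (at s within {t\<^sub>0..})" if "s \<ge> t\<^sub>0" for s
    proof -
      have "((\<lambda>t. (u i t)\<^sup>2) has_real_derivative 2 * u i s * u' i s) (at s within {t\<^sub>0..})"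
        if "i < n" for i
        using DERIV_power[OF du[OF \<open>s \<ge> t\<^sub>0\<close> that], of 2] by (simp add: u'_def d_def algebra_simps)
      then show ?thesis unfolding U_def U'_def by (intro DERIV_sum) simp
    qed
    have dN: "(N has_real_derivative N' s) (at s within {t\<^sub>0..})" if "s \<ge> t\<^sub>0" for s
      unfolding N_def N'_def x'_def d_def
      using dx dw that by (intro DERIV_sum node_energy_has_derivative) auto
    \<comment> \<open>Coercivity contributes \<open>- 2 * \<kappa> * U s\<close>, Young's inequality
      for the coupling gives back \<open>\<kappa> * U s\<close>, and one
      \<open>- \<kappa> * U s\<close> is left.\<close>
    have U'_le: "U' s \<le> - \<kappa> * U s + D\<^sup>2 / \<kappa> * X s" if "s \<ge> t\<^sub>0" for s
    proof -
      define p where "p i = u i s * (d i * u i s - (\<Sum>j<n. a i j * u j s))" for i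
      define q where "q i = u i s * (\<Sum>j<n. a i j * x j s)" for i
      have "U' s = (\<Sum>i<n. 2 * q i - 2 * p i - 2 * m s * u i s)"
        unfolding U'_def u'_def p_def q_def by (intro sum.cong refl) (simp add: ring_distribs)
      \<comment> \<open>The common velocity \<open>m s\<close> only multiplies the sum of all
        \<open>u i s\<close>, which is zero.\<close>
      also have "\<dots> = 2 * (\<Sum>i<n. q i) - 2 * (\<Sum>i<n. p i) - 2 * m s * (\<Sum>i<n. u i s)"
        by (simp only: sum_subtractf sum_distrib_left)
      finally have "U' s = 2 * (\<Sum>i<n. q i) - 2 * (\<Sum>i<n. p i) - 2 * m s * (\<Sum>i<n. u i s)" .
      moreover have "2 * (\<Sum>i<n. p i) \<ge> 2 * \<kappa> * U s"
        unfolding p_def d_def U_def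
        using poincare[OF mean[OF that]] laplacian_quadratic_form[OF sym, where u = "\<lambda>i. u i s"]
        by simp
      moreover have "2 * (\<Sum>i<n. q i) \<le> \<kappa> * U s + D\<^sup>2 / \<kappa> * X s"
        unfolding q_def U_def X_def using sym nonneg d_le \<open>0 < \<kappa>\<close> D_ge
        by (intro adjacency_cross_term_le) (auto simp: d_def)
      ultimately show ?thesis using mean[OF that] by simp
    qed
    have N'_le: "N' s \<le> - \<alpha> * X s - \<epsilon> * W s" for s
      unfolding N'_def x'_def X_def W_def sum_distrib_left sum_subtractf[symmetric]
      using \<open>0 < \<alpha>\<close> eps d_ge d_le by (intro sum_mono node_energy_dissipation[where D = D]) auto
    define V where "V t = U t + K * N t" for t
    have V_lower: "c1 * (U t + X t + W t) \<le> V t" for t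
    proof -
      have "c1 * (U t + X t + W t) \<le> 1 * U t + K * \<alpha> / 2 * X t + K / 2 * W t"
        unfolding c1_def using nonnegs by (rule min_mult_sum_le)
      also have "\<dots> \<le> V t"
        using mult_left_mono[OF N_lower[of t], of K] \<open>0 < K\<close> by (simp add: V_def algebra_simps)
      finally show ?thesis .
    qed
    have V_upper: "V t \<le> c2 * (U t + X t + W t)" for t
    proof -
      have "V t \<le> 1 * U t + 2 * K * \<alpha> * X t + 2 * K * W t"
        using mult_left_mono[OF N_upper[of t], of K] \<open>0 < K\<close> by (simp add: V_def algebra_simps)
      also have "\<dots> \<le> c2 * U t + c2 * X t + c2 * W t"
        unfolding c2_def using \<open>0 < K\<close> \<open>0 < \<alpha>\<close> nonnegs by (intro add_mono mult_right_mono) auto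
      finally show ?thesis by (simp add: algebra_simps)
    qed
    have V'_le: "U' s + K * N' s \<le> - (c3 / c2) * V s" if "s \<ge> t\<^sub>0" for s
    proof -
      have K\<alpha>: "K * \<alpha> = 2 * (D\<^sup>2 / \<kappa>)" using \<open>0 < \<alpha>\<close> by (simp add: K_def)
      have "K * N' s \<le> - (K * \<alpha>) * X s - K * \<epsilon> * W s"
        using mult_left_mono[OF N'_le[of s], of K] \<open>0 < K\<close> by (simp add: algebra_simps)
      then have "U' s + K * N' s \<le> - (\<kappa> * U s + D\<^sup>2 / \<kappa> * X s + K * \<epsilon> * W s)"
        using U'_le[OF that] unfolding K\<alpha> by (simp add: algebra_simps)
      also have "\<dots> \<le> - (c3 * (U s + X s + W s))"
        unfolding c3_def neg_le_iff_le by (rule min_mult_sum_le[OF nonnegs])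
      also have "\<dots> = - (c3 / c2) * (c2 * (U s + X s + W s))"
        using pos by simp
      \<comment> \<open>The upper bound on \<open>V\<close>, reversed by the negative factor, makes
        the dissipation proportional to \<open>V\<close> itself.\<close>
      also have "\<dots> \<le> - (c3 / c2) * V s"
        using pos V_upper[of s] by (intro mult_left_mono_neg) auto
      finally show ?thesis .
    qed
    have "V t \<le> V t\<^sub>0 * exp (- (c3 / c2) * (t - t\<^sub>0))"
    proof (rule exponential_decay[OF _ V'_le \<open>t \<ge> t\<^sub>0\<close>])
      show "(V has_real_derivative U' s + K * N' s) (at s within {t\<^sub>0..})" if "s \<ge> t\<^sub>0" for s
        unfolding V_def by (intro DERIV_add DERIV_cmult dU dN that)
    qed
    also have "\<dots> \<le> c2 * (U t\<^sub>0 + X t\<^sub>0 + W t\<^sub>0) * exp (- (c3 / c2) * (t - t\<^sub>0))"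
      by (intro mult_right_mono V_upper) simp
    finally have "c1 * (U t + X t + W t) \<le> c2 * (U t\<^sub>0 + X t\<^sub>0 + W t\<^sub>0) * exp (- (c3 / c2) * (t - t\<^sub>0))"
      using V_lower[of t] by linarith
    then have "U t + X t + W t \<le> c2 * (U t\<^sub>0 + X t\<^sub>0 + W t\<^sub>0) * exp (- (c3 / c2) * (t - t\<^sub>0)) / c1"
      using pos by (simp only: pos_le_divide_eq mult.commute)
    also have "\<dots> = c2 / c1 * exp (- (c3 / c2) * (t - t\<^sub>0)) * (U t\<^sub>0 + X t\<^sub>0 + W t\<^sub>0)"
      by simp
    finally show "(\<Sum>i<n. (u i t)\<^sup>2) + (\<Sum>i<n. (x i t)\<^sup>2) + (\<Sum>i<n. (w i t)\<^sup>2) \<le>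
        c2 / c1 * exp (- (c3 / c2) * (t - t\<^sub>0)) *
          ((\<Sum>i<n. (u i t\<^sub>0)\<^sup>2) + (\<Sum>i<n. (x i t\<^sub>0)\<^sup>2) + (\<Sum>i<n. (w i t\<^sub>0)\<^sup>2))"
      by (simp add: U_def X_def W_def)
  qed
qed


section \<open>Mean-free coordinates for the differences\<close>

text \<open>The mean-free state whose differences \<open>u 0 - u (Suc k)\<close> are \<open>z k\<close>; only \<open>k < n - 1\<close> matters.\<close>

definition centred_state :: "nat \<Rightarrow> (nat \<Rightarrow> real) \<Rightarrow> nat \<Rightarrow> real" where
  "centred_state n z i = (\<Sum>k<n - 1. z k) / real n - (case i of 0 \<Rightarrow> 0 | Suc k \<Rightarrow> z k)"

lemma centred_state_diff: "centred_state n z 0 - centred_state n z (Suc k) = z k"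
  by (simp add: centred_state_def)

lemma centred_state_sum:
  assumes "0 < n"
  shows "(\<Sum>i<n. centred_state n z i) = 0"
proof -
  obtain m where n: "n = Suc m" using assms gr0_implies_Suc by blast
  have "(\<Sum>i<n. case i of 0 \<Rightarrow> 0 | Suc k \<Rightarrow> z k) = (\<Sum>k<n - 1. z k)"
    unfolding n sum.lessThan_Suc_shift by simp
  then show ?thesis
    using assms by (simp add: centred_state_def sum_subtractf)
qed

text \<open>Subtracting its value at index 0 from the centred state leaves 0 at index 0 and
  \<open>- z k\<close> at \<open>Suc k\<close>, so this is the shift inequality for mean-free
  vectors.\<close>

lemma centred_state_sum_squares_le:
  assumes "0 < n"
  shows "(\<Sum>i<n. (centred_state n z i)\<^sup>2) \<le> (\<Sum>k<n - 1. (z k)\<^sup>2)"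
proof -
  obtain m where n: "n = Suc m" using assms gr0_implies_Suc by blast
  have "(\<Sum>i<n. (centred_state n z i)\<^sup>2) \<le> (\<Sum>i<n. (centred_state n z i - centred_state n z 0)\<^sup>2)"
    by (rule sum_squares_le_sum_squares_shifted[OF centred_state_sum[OF assms]])
  also have "\<dots> = (\<Sum>k<n - 1. (z k)\<^sup>2)"
    unfolding n sum.lessThan_Suc_shift by (simp add: centred_state_def)
  finally show ?thesis .
qed

text \<open>Converse comparison, needed to return from the mean-free state to \<open>z\<close>. Each
  \<open>z k\<close> is a difference of two entries, and the entry at 0 occurs in all of them,
  whence the factor \<open>real n\<close>.\<close>

lemma sum_squares_le_centred_state:
  assumes "0 < n"
  shows "(\<Sum>k<n - 1. (z k)\<^sup>2) \<le> 2 * real n * (\<Sum>i<n. (centred_state n z i)\<^sup>2)"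
proof -
  obtain m where n: "n = Suc m" using assms gr0_implies_Suc by blast
  define u where "u = centred_state n z"
  have "(z k)\<^sup>2 \<le> 2 * (u 0)\<^sup>2 + 2 * (u (Suc k))\<^sup>2" for k
  proof -
    have z: "z k = u 0 - u (Suc k)" by (simp add: u_def centred_state_diff)
    have "0 \<le> (u 0 + u (Suc k))\<^sup>2" by simp
    then show ?thesis unfolding z by (simp add: power2_eq_square algebra_simps)
  qed
  then have "(\<Sum>k<m. (z k)\<^sup>2) \<le> (\<Sum>k<m. 2 * (u 0)\<^sup>2 + 2 * (u (Suc k))\<^sup>2)"
    by (intro sum_mono)
  also have "\<dots> = real m * (2 * (u 0)\<^sup>2) + 2 * (\<Sum>k<m. (u (Suc k))\<^sup>2)"
    by (simp add: sum.distrib sum_distrib_left)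
  \<comment> \<open>Both coefficients, \<open>real m\<close> and 1, are raised to
    \<open>real n\<close> so that the two parts join into one sum.\<close>
  also have "\<dots> \<le> real n * (2 * (u 0)\<^sup>2) + real n * (2 * (\<Sum>k<m. (u (Suc k))\<^sup>2))"
    unfolding n by (intro add_mono mult_right_mono) (auto simp: sum_nonneg algebra_simps)
  also have "\<dots> = 2 * real n * (\<Sum>i<n. (u i)\<^sup>2)"
    unfolding n sum.lessThan_Suc_shift by (simp add: algebra_simps)
  finally show ?thesis by (simp add: n u_def)
qed

text \<open>Differences of a velocity \<open>h\<close> determine it up to a common constant; having
  zero sum fixes that constant, so the centred state moves with \<open>h\<close> minus its
  mean.\<close>

lemma centred_state_has_derivative:
  assumes "i < n"
    and deriv: "\<And>k. k < n - 1 \<Longrightarrow> (z k has_real_derivative h 0 - h (Suc k)) (at t within S)"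
  shows "((\<lambda>t. centred_state n (\<lambda>k. z k t) i) has_real_derivative h i - (\<Sum>j<n. h j) / real n)
           (at t within S)"
proof -
  obtain m where n: "n = Suc m" using assms(1) by (cases n) auto
  have sum: "((\<lambda>t. (\<Sum>k<m. z k t) / real n) has_real_derivative (\<Sum>k<m. h 0 - h (Suc k)) / real n)
      (at t within S)"
    using deriv n by (intro DERIV_cdivide DERIV_sum) auto
  have eq: "(\<Sum>k<m. h 0 - h (Suc k)) / real n = h 0 - (\<Sum>j<n. h j) / real n"
    unfolding n sum.lessThan_Suc_shift by (simp add: sum_subtractf field_simps)
  show ?thesis
  proof (cases i)
    case 0
    then show ?thesis using sum unfolding eq by (simp add: centred_state_def n)
  next
    case (Suc k)
    then have "k < n - 1" using assms(1) by simp
    from DERIV_diff[OF sum deriv[OF this]] show ?thesis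
      unfolding eq using Suc by (simp add: centred_state_def n algebra_simps)
  qed
qed

section \<open>Coordinates of concatenations and matrix products\<close>

lemma euclidean_norm_append:
  "euclidean_norm (v @\<^sub>v w) = sqrt ((\<Sum>i<dim_vec v. (vec_index v i)\<^sup>2) + (\<Sum>i<dim_vec w. (vec_index w i)\<^sup>2))"
proof -
  \<comment> \<open>A sum of squares is the scalar product of a vector with itself, which splits
    over concatenation.\<close>
  have "(\<Sum>i<dim_vec (v @\<^sub>v w). (vec_index (v @\<^sub>v w) i)\<^sup>2)
      = (\<Sum>i<dim_vec v. (vec_index v i)\<^sup>2) + (\<Sum>i<dim_vec w. (vec_index w i)\<^sup>2)"
    using scalar_prod_append[OF carrier_vec_dim_vec carrier_vec_dim_vec carrier_vec_dim_vec
        carrier_vec_dim_vec, of v w]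
    by (simp only: scalar_prod_def power2_eq_square lessThan_atLeast0)
  then show ?thesis by (simp add: euclidean_norm_def L2_set_def)
qed

text \<open>Padding \<open>z\<close> with a final zero silences the deleted column, and the deleted
  row lies below row \<open>i\<close>.\<close>

lemma mat_delete_last_mult_vec:
  assumes "M \<in> carrier_mat n n" "z \<in> carrier_vec (n - 1)" "i < n - 1"
  shows "vec_index (mat_delete M (n - 1) (n - 1) *\<^sub>v z) i
      = vec_index (M *\<^sub>v Matrix.vec n (\<lambda>i. if i < n - 1 then vec_index z i else 0)) i"
proof -
  obtain m where n: "n = Suc m" using assms(3) by (cases n) auto
  show ?thesis
    using assms unfolding n
    by (auto simp: scalar_prod_def mat_delete_def intro!: sum.cong)
qed

lemma delete_row_last_mult_vec:
  assumes "M \<in> carrier_mat n n" "x \<in> carrier_vec n" "i < n - 1"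
  shows "vec_index (delete_row M (n - 1) *\<^sub>v x) i = vec_index (M *\<^sub>v x) i"
  using assms by (auto simp: scalar_prod_def delete_row_def intro!: sum.cong)

lemma adjacency_matrix_carrier: "adjacency_matrix n G \<in> carrier_mat n n"
  by (simp add: adjacency_matrix_def)

lemma degree_matrix_carrier: "degree_matrix n G \<in> carrier_mat n n"
  by (simp add: degree_matrix_def mat_diag_def)

lemma adjacency_matrix_mult_vec:
  assumes "v \<in> carrier_vec n" "i < n"
  shows "vec_index (adjacency_matrix n G *\<^sub>v v) i
      = (\<Sum>j<n. adjacency_matrix n G $$ (i, j) * vec_index v j)"
  using assms by (simp add: adjacency_matrix_def scalar_prod_def atLeast0LessThan)

lemma degree_matrix_mult_vec:
  assumes "v \<in> carrier_vec n" "i < n"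
  shows "vec_index (degree_matrix n G *\<^sub>v v) i = real (node_degree G (Suc i)) * vec_index v i"
  using assms unfolding degree_matrix_def mat_diag_def
  by (simp add: scalar_prod_def atLeast0LessThan if_distrib[of "\<lambda>c. c * _"] cong: if_cong)

lemma laplacian_matrix_mult_vec:
  assumes "v \<in> carrier_vec n" "i < n"
  shows "vec_index (laplacian_matrix n G *\<^sub>v v) i = real (node_degree G (Suc i)) * vec_index v i
      - (\<Sum>j<n. adjacency_matrix n G $$ (i, j) * vec_index v j)"
  unfolding laplacian_matrix_def
    minus_mult_distrib_mat_vec[OF degree_matrix_carrier adjacency_matrix_carrier assms(1)]
  using degree_matrix_mult_vec[OF assms] adjacency_matrix_mult_vec[OF assms]
    degree_matrix_carrier[of n G] adjacency_matrix_carrier[of n G] assms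
  by simp

section \<open>Graph properties of the adjacency matrix\<close>

lemma adjacency_matrix_symmetric:
  assumes "pair_graph G" "i < n" "j < n"
  shows "adjacency_matrix n G $$ (i, j) = adjacency_matrix n G $$ (j, i)"
proof -
  interpret pair_graph G by fact
  show ?thesis
    using assms arcs_symmetric by (auto simp: adjacency_matrix_def)
qed

lemma adjacency_matrix_nonneg:
  assumes "i < n" "j < n"
  shows "0 \<le> adjacency_matrix n G $$ (i, j)"
  using assms by (simp add: adjacency_matrix_def)

lemma adjacency_matrix_row_sum:
  assumes "pverts G = {1..n}" "i < n"
  shows "(\<Sum>j<n. adjacency_matrix n G $$ (i, j)) = real (node_degree G (Suc i))"
proof -
  \<comment> \<open>Nodes are shifted indices: \<open>Suc\<close> maps the neighbouring indices
    bijectively onto the neighbouring nodes.\<close>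
  have "{u \<in> pverts G. (Suc i, u) \<in> parcs G} = Suc ` {j \<in> {..<n}. (Suc i, Suc j) \<in> parcs G}"
    unfolding assms(1) image_iff set_eq_iff
    by (auto simp: Bex_def) (metis Suc_le_D less_eq_Suc_le)
  then have "node_degree G (Suc i) = card {j \<in> {..<n}. (Suc i, Suc j) \<in> parcs G}"
    by (simp add: node_degree_def card_image)
  then show ?thesis
    using assms(2) by (simp add: adjacency_matrix_def flip: sum.inter_filter)
qed

lemma adjacency_matrix_reachable:
  assumes "pair_graph G" "pverts G = {1..n}" "Digraph_Component.connected (with_proj G)"
    and "i < n" "j < n"
  shows "(i, j) \<in> {(i, j). i < n \<and> j < n \<and> 0 < adjacency_matrix n G $$ (i, j)}\<^sup>*"
proof -
  interpret pair_graph G by fact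
  let ?R = "{(i, j). i < n \<and> j < n \<and> 0 < adjacency_matrix n G $$ (i, j)}"
  \<comment> \<open>Connectedness means strong connectedness of the symmetric closure; the arcs of
    \<open>G\<close> are already symmetric, so the closure adds none.\<close>
  have "Suc i \<rightarrow>\<^sup>*\<^bsub>with_proj (mk_symmetric (with_proj G))\<^esub> Suc j"
    using assms by (auto simp: connected_def strongly_connected_def)
  then have "(Suc i, Suc j) \<in> (arcs_ends (with_proj (mk_symmetric (with_proj G))))\<^sup>*"
    by (rule reachable_rtranclI)
  then have "(Suc i, Suc j) \<in> (parcs G)\<^sup>*"
    using adj_mk_symmetric_eq[OF sym_arcs] by simp
  \<comment> \<open>The endpoint is written \<open>Suc j - 1\<close> so that the induction can run
    over nodes, each shifted back to its index. Arcs only join nodes in \<open>{1..n}\<close>, so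
    the subtraction is never truncated.\<close>
  then have "(i, Suc j - 1) \<in> ?R\<^sup>*"
  proof (induction rule: rtrancl_induct)
    case base
    show ?case by simp
  next
    case (step p q)
    have "p \<in> {1..n}" "q \<in> {1..n}"
      using step.hyps(2) wellformed assms(2) by auto
    then have "(p - 1, q - 1) \<in> ?R"
      using step.hyps(2) by (auto simp: adjacency_matrix_def)
    with step.IH show ?case by (rule rtrancl_into_rtrancl)
  qed
  then show ?thesis by simp
qed

text \<open>As \<open>2 \<le> n\<close>, there is another index \<open>j\<close>; a path from
  \<open>i\<close> to \<open>j\<close> is nonempty, and its first edge contributes an entry 1 to row
  \<open>i\<close>.\<close>

lemma adjacency_matrix_row_sum_ge_1:
  assumes "pair_graph G" "pverts G = {1..n}" "Digraph_Component.connected (with_proj G)"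
    and "2 \<le> n" "i < n"
  shows "1 \<le> (\<Sum>j<n. adjacency_matrix n G $$ (i, j))"
proof -
  define j where "j = (if i = 0 then 1 else 0 :: nat)"
  have "j < n" "j \<noteq> i" using assms by (auto simp: j_def)
  with adjacency_matrix_reachable[OF assms(1-3,5)]
  obtain k where k: "k < n" "0 < adjacency_matrix n G $$ (i, k)"
    by (blast elim: converse_rtranclE)
  then have "adjacency_matrix n G $$ (i, k) = 1"
    using assms by (auto simp: adjacency_matrix_def split: if_splits)
  moreover have "adjacency_matrix n G $$ (i, k) \<le> (\<Sum>j<n. adjacency_matrix n G $$ (i, j))"
    using k assms adjacency_matrix_nonneg by (intro member_le_sum) auto
  ultimately show ?thesis by simp
qed

section \<open>The reduced Laplacian in difference coordinates\<close>

text \<open>\<open>T\<close> sends the centred state to \<open>z\<close> padded with 0, because its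
  differences are \<open>z\<close> and its sum is 0. So \<open>T_inv\<close> recovers the centred
  state from the padded vector, and applying \<open>T * L\<close> then yields the differences of
  \<open>v\<close>.\<close>

lemma reduced_laplacian_mult_vec:
  assumes "0 < n"
    and T: "T \<in> carrier_mat n n" "\<And>x. x \<in> carrier_vec n \<Longrightarrow> T *\<^sub>v x = differences_and_sum n x"
    and T_inv: "T_inv \<in> carrier_mat n n" "inverts_mat T_inv T"
    and L: "L \<in> carrier_mat n n" and z: "z \<in> carrier_vec (n - 1)" and "k < n - 1"
  defines "v \<equiv> L *\<^sub>v Matrix.vec n (centred_state n (vec_index z))"
  shows "vec_index (mat_delete (- (T * L * T_inv)) (n - 1) (n - 1) *\<^sub>v z) k
           = - (vec_index v 0 - vec_index v (Suc k))"
proof -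
  define zz where "zz = Matrix.vec n (\<lambda>i. if i < n - 1 then vec_index z i else 0)"
  define u where "u = Matrix.vec n (centred_state n (vec_index z))"
  have carr: "zz \<in> carrier_vec n" "u \<in> carrier_vec n" "v \<in> carrier_vec n"
    using L by (auto simp: zz_def u_def v_def)
  have "T *\<^sub>v u = zz"
    unfolding T(2)[OF carr(2)]
    using \<open>0 < n\<close> centred_state_sum[OF \<open>0 < n\<close>, of "vec_index z"]
    by (intro eq_vecI) (auto simp: differences_and_sum_def u_def zz_def centred_state_diff)
  then have "T_inv *\<^sub>v zz = (T_inv * T) *\<^sub>v u"
    using assoc_mult_mat_vec[OF T_inv(1) T(1) carr(2)] by simp
  also have "\<dots> = u"
    using T_inv carr by (simp add: inverts_mat_def)
  finally have u: "T_inv *\<^sub>v zz = u" .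
  have "(T * L * T_inv) *\<^sub>v zz = T *\<^sub>v v"
    using T(1) T_inv(1) L carr by (simp add: u assoc_mult_mat_vec[of _ n n _ n] v_def u_def)
  also have "\<dots> = differences_and_sum n v"
    using carr T(2) by simp
  finally have "vec_index (- (T * L * T_inv) *\<^sub>v zz) k = - vec_index (differences_and_sum n v) k"
    using T(1) T_inv(1) L carr \<open>k < n - 1\<close> by (simp add: differences_and_sum_def)
  then show ?thesis
    using \<open>k < n - 1\<close> mat_delete_last_mult_vec[of "- (T * L * T_inv)" n z k] T(1) T_inv(1) L z
    by (simp add: zz_def differences_and_sum_def)
qed


section \<open>From the matrix system to the network estimate\<close>

theorem mainTheorem1:
  fixes n :: nat and G :: "nat pair_pre_digraph" and \<alpha> t\<^sub>0 :: real
    and T T_inv A\<^sub>1 A\<^sub>2 :: "real mat"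
  assumes "n \<ge> 2"
    and "pair_graph G" and "pverts G = {1..n}" and "Digraph_Component.connected (with_proj G)"
    and "\<alpha> > 0"
    and "T \<in> carrier_mat n n"
    and "\<And>x. x \<in> carrier_vec n \<Longrightarrow> T *\<^sub>v x = differences_and_sum n x"
    and "T_inv \<in> carrier_mat n n" and "inverts_mat T T_inv" and "inverts_mat T_inv T"
    and "A\<^sub>1 = mat_delete (- (T * laplacian_matrix n G * T_inv)) (n - 1) (n - 1)"
    and "A\<^sub>2 = delete_row (T * adjacency_matrix n G) (n - 1)"
  shows "\<exists>c>0. \<exists>\<mu>>0.
    \<forall>z\<^sub>0 \<in> carrier_vec (n - 1). \<forall>x\<^sub>0 \<in> carrier_vec n. \<forall>w\<^sub>0 \<in> carrier_vec n.
    \<forall>z x w :: real \<Rightarrow> real vec.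
      (\<forall>t\<ge>t\<^sub>0. z t \<in> carrier_vec (n - 1) \<and> x t \<in> carrier_vec n \<and> w t \<in> carrier_vec n) \<and>
      z t\<^sub>0 = z\<^sub>0 \<and> x t\<^sub>0 = x\<^sub>0 \<and> w t\<^sub>0 = w\<^sub>0 \<and>
      (\<forall>t\<ge>t\<^sub>0.
         has_vec_derivative_within z (A\<^sub>1 *\<^sub>v z t + A\<^sub>2 *\<^sub>v x t) t {t\<^sub>0..} \<and>
         has_vec_derivative_within x ((- degree_matrix n G) *\<^sub>v x t - w t) t {t\<^sub>0..} \<and>
         has_vec_derivative_within w (\<alpha> \<cdot>\<^sub>v x t) t {t\<^sub>0..})
      \<longrightarrow> (\<forall>t\<ge>t\<^sub>0. euclidean_norm (z t @\<^sub>v x t @\<^sub>v w t)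
              \<le> c * exp (- \<mu> * (t - t\<^sub>0)) * euclidean_norm (z\<^sub>0 @\<^sub>v x\<^sub>0 @\<^sub>v w\<^sub>0))"
proof -
  note n = \<open>n \<ge> 2\<close> and G = \<open>pair_graph G\<close> \<open>pverts G = {1..n}\<close> \<open>Digraph_Component.connected (with_proj G)\<close>
  note T = \<open>T \<in> carrier_mat n n\<close> assms(7) and T_inv = \<open>T_inv \<in> carrier_mat n n\<close> \<open>inverts_mat T_inv T\<close>
  have "0 < n" using n by simp
  define a where "a i j = adjacency_matrix n G $$ (i, j)" for i j
  have row_sum: "real (node_degree G (Suc i)) = (\<Sum>j<n. a i j)" if "i < n" for i
    using adjacency_matrix_row_sum[OF G(2) that] by (simp add: a_def)
  have sym: "a i j = a j i" and nonneg: "0 \<le> a i j"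
    and reach: "(i, j) \<in> {(i, j). i < n \<and> j < n \<and> 0 < a i j}\<^sup>*" if "i < n" "j < n" for i j
    using adjacency_matrix_symmetric[OF G(1)] adjacency_matrix_nonneg adjacency_matrix_reachable[OF G] that
    by (auto simp: a_def)
  have deg: "1 \<le> (\<Sum>j<n. a i j)" if "i < n" for i
    using adjacency_matrix_row_sum_ge_1[OF G n that] by (simp add: a_def)
  obtain \<kappa> where \<kappa>: "0 < \<kappa>" "\<And>u :: nat \<Rightarrow> real. (\<Sum>i<n. u i) = 0 \<Longrightarrow>
      2 * \<kappa> * (\<Sum>i<n. (u i)\<^sup>2) \<le> (\<Sum>i<n. \<Sum>j<n. a i j * (u i - u j)\<^sup>2)"
    using connected_poincare[OF nonneg reach] by blast
  obtain c \<mu> where "0 < c" "0 < \<mu>" and decay: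
    "\<And>t\<^sub>0 t u x w m. (\<And>t. t \<ge> t\<^sub>0 \<Longrightarrow> (\<Sum>i<n. u i t) = 0) \<Longrightarrow>
      (\<And>t i. t \<ge> t\<^sub>0 \<Longrightarrow> i < n \<Longrightarrow> (u i has_real_derivative
        - ((\<Sum>j<n. a i j) * u i t - (\<Sum>j<n. a i j * u j t)) + (\<Sum>j<n. a i j * x j t) - m t)
          (at t within {t\<^sub>0..})) \<Longrightarrow>
      (\<And>t i. t \<ge> t\<^sub>0 \<Longrightarrow> i < n \<Longrightarrow> (x i has_real_derivative - (\<Sum>j<n. a i j) * x i t - w i t)
          (at t within {t\<^sub>0..})) \<Longrightarrow>
      (\<And>t i. t \<ge> t\<^sub>0 \<Longrightarrow> i < n \<Longrightarrow> (w i has_real_derivative \<alpha> * x i t) (at t within {t\<^sub>0..})) \<Longrightarrow>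
      t \<ge> t\<^sub>0 \<Longrightarrow>
      (\<Sum>i<n. (u i t)\<^sup>2) + (\<Sum>i<n. (x i t)\<^sup>2) + (\<Sum>i<n. (w i t)\<^sup>2) \<le>
        c * exp (- \<mu> * (t - t\<^sub>0)) *
          ((\<Sum>i<n. (u i t\<^sub>0)\<^sup>2) + (\<Sum>i<n. (x i t\<^sub>0)\<^sup>2) + (\<Sum>i<n. (w i t\<^sub>0)\<^sup>2))"
    using network_exponential_decay[OF sym nonneg deg \<open>\<alpha> > 0\<close> \<kappa>] by blast
  \<comment> \<open>The squared norm decays at rate \<open>\<mu>\<close>, hence the norm at
    \<open>\<mu> / 2\<close>; the factor \<open>2 * real n\<close> is the cost of returning from the
    mean-free state to the differences.\<close>
  have bound: "euclidean_norm (z t @\<^sub>v x t @\<^sub>v w t)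
      \<le> sqrt (2 * real n * c) * exp (- (\<mu> / 2) * (t - t\<^sub>0)) * euclidean_norm (z t\<^sub>0 @\<^sub>v x t\<^sub>0 @\<^sub>v w t\<^sub>0)"
    if carr: "\<And>t. t \<ge> t\<^sub>0 \<Longrightarrow> z t \<in> carrier_vec (n - 1)" "\<And>t. t \<ge> t\<^sub>0 \<Longrightarrow> x t \<in> carrier_vec n"
        "\<And>t. t \<ge> t\<^sub>0 \<Longrightarrow> w t \<in> carrier_vec n"
      and dz: "\<And>t. t \<ge> t\<^sub>0 \<Longrightarrow>
        has_vec_derivative_within z (A\<^sub>1 *\<^sub>v z t + A\<^sub>2 *\<^sub>v x t) t {t\<^sub>0..}"
      and dx: "\<And>t. t \<ge> t\<^sub>0 \<Longrightarrow>
        has_vec_derivative_within x ((- degree_matrix n G) *\<^sub>v x t - w t) t {t\<^sub>0..}"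
      and dw: "\<And>t. t \<ge> t\<^sub>0 \<Longrightarrow> has_vec_derivative_within w (\<alpha> \<cdot>\<^sub>v x t) t {t\<^sub>0..}"
      and "t \<ge> t\<^sub>0"
    for z x w :: "real \<Rightarrow> real vec" and t
  proof -
    define u where "u i s = centred_state n (\<lambda>k. vec_index (z s) k) i" for i s
    \<comment> \<open>The velocity \<open>- L u + A x\<close> before centring; its differences will
      be shown to be the right-hand side of the equation for \<open>z\<close>.\<close>
    define h where "h s i = - ((\<Sum>j<n. a i j) * u i s - (\<Sum>j<n. a i j * u j s))
        + (\<Sum>j<n. a i j * vec_index (x s) j)" for s i
    have dz': "((\<lambda>s. vec_index (z s) k) has_real_derivative h s 0 - h s (Suc k)) (at s within {t\<^sub>0..})"
      if s: "s \<ge> t\<^sub>0" and k: "k < n - 1" for s k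
    proof -
      define v where "v = laplacian_matrix n G *\<^sub>v Matrix.vec n (centred_state n (vec_index (z s)))"
      define y where "y = adjacency_matrix n G *\<^sub>v x s"
      have L: "laplacian_matrix n G \<in> carrier_mat n n"
        unfolding laplacian_matrix_def by (rule minus_carrier_mat[OF adjacency_matrix_carrier])
      have y: "y \<in> carrier_vec n"
        unfolding y_def using adjacency_matrix_carrier carr(2)[OF s] by (rule mult_mat_vec_carrier)
      have h: "h s i = - vec_index v i + vec_index y i" if "i < n" for i
        unfolding h_def v_def y_def laplacian_matrix_mult_vec[OF vec_carrier that]
          adjacency_matrix_mult_vec[OF carr(2)[OF s] that] row_sum[OF that]
        using that by (simp add: a_def u_def)
      \<comment> \<open>Deleting the last row discards the sum coordinate of \<open>T\<close> and
        keeps the differences.\<close>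
      have "vec_index (A\<^sub>2 *\<^sub>v x s) k = vec_index ((T * adjacency_matrix n G) *\<^sub>v x s) k"
        unfolding \<open>A\<^sub>2 = _\<close> using T(1) adjacency_matrix_carrier carr(2)[OF s] k
        by (intro delete_row_last_mult_vec) auto
      also have "(T * adjacency_matrix n G) *\<^sub>v x s = differences_and_sum n y"
        using assoc_mult_mat_vec[OF T(1) adjacency_matrix_carrier carr(2)[OF s]] T(2)[OF y]
        by (simp add: y_def)
      finally have "vec_index (A\<^sub>2 *\<^sub>v x s) k = vec_index y 0 - vec_index y (Suc k)"
        using k by (simp add: differences_and_sum_def)
      moreover have "vec_index (A\<^sub>1 *\<^sub>v z s) k = - (vec_index v 0 - vec_index v (Suc k))"
        unfolding \<open>A\<^sub>1 = _\<close> v_def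
        using \<open>0 < n\<close> T T_inv L carr(1)[OF s] k by (rule reduced_laplacian_mult_vec)
      moreover have dims: "dim_row A\<^sub>1 = n - 1" "dim_row A\<^sub>2 = n - 1"
        using T(1) T_inv(1) by (auto simp: \<open>A\<^sub>1 = _\<close> \<open>A\<^sub>2 = _\<close> delete_row_def)
      ultimately have "vec_index (A\<^sub>1 *\<^sub>v z s + A\<^sub>2 *\<^sub>v x s) k = h s 0 - h s (Suc k)"
        using h[of 0] h[of "Suc k"] \<open>0 < n\<close> k by (simp del: index_mult_mat_vec)
      then show ?thesis
        using dz[OF s] dims k by (auto simp: has_vec_derivative_within_def)
    qed
    have "(\<Sum>i<n. (u i t)\<^sup>2) + (\<Sum>i<n. (vec_index (x t) i)\<^sup>2) + (\<Sum>i<n. (vec_index (w t) i)\<^sup>2) \<le>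
        c * exp (- \<mu> * (t - t\<^sub>0)) * ((\<Sum>i<n. (u i t\<^sub>0)\<^sup>2)
          + (\<Sum>i<n. (vec_index (x t\<^sub>0) i)\<^sup>2) + (\<Sum>i<n. (vec_index (w t\<^sub>0) i)\<^sup>2))"
    \<comment> \<open>The mean of \<open>h\<close> is the velocity that centring removes.\<close>
    proof (rule decay[where m = "\<lambda>s. (\<Sum>j<n. h s j) / real n"])
      show "(\<Sum>i<n. u i s) = 0" for s
        unfolding u_def by (rule centred_state_sum[OF \<open>0 < n\<close>])
      show "(u i has_real_derivative - ((\<Sum>j<n. a i j) * u i s - (\<Sum>j<n. a i j * u j s))
          + (\<Sum>j<n. a i j * vec_index (x s) j) - (\<Sum>j<n. h s j) / real n) (at s within {t\<^sub>0..})"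
        if "s \<ge> t\<^sub>0" "i < n" for s i
        using centred_state_has_derivative[OF that(2) dz'[OF that(1)]]
        unfolding h_def[of s i, symmetric] by (simp add: u_def[abs_def])
      show "((\<lambda>s. vec_index (x s) i) has_real_derivative
          - (\<Sum>j<n. a i j) * vec_index (x s) i - vec_index (w s) i) (at s within {t\<^sub>0..})"
        if s: "s \<ge> t\<^sub>0" and i: "i < n" for s i
      proof -
        have "vec_index ((- degree_matrix n G) *\<^sub>v x s - w s) i
            = - (\<Sum>j<n. a i j) * vec_index (x s) i - vec_index (w s) i"
          using degree_matrix_mult_vec[OF carr(2)[OF s] i, of G] row_sum[OF i]
            degree_matrix_carrier[of n G] carr(2,3)[OF s] i
          by (simp del: index_mult_mat_vec)
        then show ?thesis
          using dx[OF s] carr(3)[OF s] i by (auto simp: has_vec_derivative_within_def)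
      qed
      show "((\<lambda>s. vec_index (w s) i) has_real_derivative \<alpha> * vec_index (x s) i) (at s within {t\<^sub>0..})"
        if "s \<ge> t\<^sub>0" "i < n" for s i
        using dw[OF that(1)] carr(2)[OF that(1)] that(2)
        by (auto simp: has_vec_derivative_within_def)
    qed fact
    \<comment> \<open>\<open>S\<close> is the squared norm in the original coordinates. At the
      initial time it dominates the squared norm with \<open>u\<close> in place of
      \<open>z\<close>.\<close>
    moreover define S where "S s = (\<Sum>k<n - 1. (vec_index (z s) k)\<^sup>2)
        + ((\<Sum>i<n. (vec_index (x s) i)\<^sup>2) + (\<Sum>i<n. (vec_index (w s) i)\<^sup>2))" for s
    moreover have "(\<Sum>i<n. (u i t\<^sub>0)\<^sup>2) \<le> (\<Sum>k<n - 1. (vec_index (z t\<^sub>0) k)\<^sup>2)"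
      unfolding u_def by (rule centred_state_sum_squares_le[OF \<open>0 < n\<close>])
    ultimately have decay_S: "(\<Sum>i<n. (u i t)\<^sup>2) + (\<Sum>i<n. (vec_index (x t) i)\<^sup>2)
        + (\<Sum>i<n. (vec_index (w t) i)\<^sup>2) \<le> c * exp (- \<mu> * (t - t\<^sub>0)) * S t\<^sub>0"
      using \<open>0 < c\<close> by (elim order_trans, intro mult_left_mono) auto
    \<comment> \<open>The factor paid for \<open>z\<close> is at least 1, so it may be put on the
      \<open>x\<close> and \<open>w\<close> sums too and then pulled out.\<close>
    have "1 \<le> 2 * real n" using n by simp
    then have le: "y \<le> 2 * real n * y" if "0 \<le> y" for y :: real
      using mult_right_mono[of 1 "2 * real n" y] that by simp
    have "S t \<le> 2 * real n * (\<Sum>i<n. (u i t)\<^sup>2) + (2 * real n * (\<Sum>i<n. (vec_index (x t) i)\<^sup>2)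
        + 2 * real n * (\<Sum>i<n. (vec_index (w t) i)\<^sup>2))"
      unfolding S_def u_def
      by (intro add_mono sum_squares_le_centred_state le \<open>0 < n\<close> sum_nonneg) auto
    also have "\<dots> \<le> 2 * real n * (c * exp (- \<mu> * (t - t\<^sub>0)) * S t\<^sub>0)"
      using mult_left_mono[OF decay_S, of "2 * real n"] by (simp add: distrib_left)
    \<comment> \<open>The exponential is written as the square of its half-rate version, ready for
      the square root.\<close>
    also have "\<dots> = (2 * real n * c) * (exp (- (\<mu> / 2) * (t - t\<^sub>0)))\<^sup>2 * S t\<^sub>0"
      by (simp add: power2_eq_square flip: exp_add)
    finally have "sqrt (S t) \<le> sqrt ((2 * real n * c) * (exp (- (\<mu> / 2) * (t - t\<^sub>0)))\<^sup>2 * S t\<^sub>0)"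
      by simp
    also have "\<dots> = sqrt (2 * real n * c) * exp (- (\<mu> / 2) * (t - t\<^sub>0)) * sqrt (S t\<^sub>0)"
      by (simp add: real_sqrt_mult)
    finally have "sqrt (S t) \<le> sqrt (2 * real n * c) * exp (- (\<mu> / 2) * (t - t\<^sub>0)) * sqrt (S t\<^sub>0)" .
    moreover have "euclidean_norm (z s @\<^sub>v x s @\<^sub>v w s) = sqrt (S s)" if "s \<ge> t\<^sub>0" for s
    proof -
      have "(\<Sum>i<dim_vec (x s @\<^sub>v w s). (vec_index (x s @\<^sub>v w s) i)\<^sup>2)
          = (\<Sum>i<n. (vec_index (x s) i)\<^sup>2) + (\<Sum>i<n. (vec_index (w s) i)\<^sup>2)"
        using euclidean_norm_append[of "x s" "w s"] carr[OF that]
        by (simp add: euclidean_norm_def L2_set_def)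
      then show ?thesis
        using carr[OF that] by (simp add: euclidean_norm_append S_def)
    qed
    ultimately show ?thesis using \<open>t \<ge> t\<^sub>0\<close> by simp
  qed
  \<comment> \<open>Both constants are fixed before any trajectory is considered, so the bound is
    uniform in the initial condition.\<close>
  have pos: "0 < sqrt (2 * real n * c)" "0 < \<mu> / 2"
    using \<open>0 < n\<close> \<open>0 < c\<close> \<open>0 < \<mu>\<close> by simp_all
  show ?thesis
    by (rule exI[of _ "sqrt (2 * real n * c)"], rule conjI[OF pos(1)],
        rule exI[of _ "\<mu> / 2"], rule conjI[OF pos(2)]) (clarify, rule bound; blast)
qed

end
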